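(* Let $(X,f_{1,\infty})$ be a non-autonomous discrete system such that $X$ is a compact metric space without isolated points and $f_{1,\infty}$ is commutative. If $(X,f_{1,\infty})$ is topologically transitive and has a fixed point, then $(X,f_{1,\infty})$ is Li-Yorke chaotic.
   Context: $\mathbb{N}=\{1,2,3,\dots\}$. A non-autonomous discrete system (NDS) $(X,f_{1,\infty})$ consists of a metric space $(X,d)$ and a sequence $f_{1,\infty}=(f_n)_{n=1}^\infty$ of continuous maps $f_n:X\to X$. For $i,n\in\mathbb{N}$, $f_i^n:=f_{i+n-1}\circ\cdots\circ f_i$, and $f_i^0=\mathrm{id}_X$. Commutative: $f_i\circ f_j=f_j\circ f_i$ for all $i,j\in\mathbb{N}$. Topologically transitive: for any two non-empty open sets $U,V\subseteq X$ there is $n\in\mathbb{N}$ with $f_1^n(U)\cap V\neq\emptyset$. Fixed point: a point $x\in X$ with $f_1^n(x)=x$ for all $n\in\mathbb{N}$. Li-Yorke chaotic: there is an uncountable set $S\subseteq X$ such that for any two different points $x,y\in S$, $\liminf_{n\to\infty}d(f_1^n(x),f_1^n(y))=0$ and $\limsup_{n\to\infty}d(f_1^n(x),f_1^n(y))>0$. *)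

theory Defs
  imports "HOL-Analysis.Analysis"
begin

text \<open>
  The space is a subset \<^term>\<open>X\<close> of a metric space type, with the metric and topology
  of the subspace. Sequences of maps are indexed from 1; the value at index 0 is never used.
\<close>

definition nds :: "'a::metric_space set \<Rightarrow> (nat \<Rightarrow> 'a \<Rightarrow> 'a) \<Rightarrow> bool" where
  "nds X f \<longleftrightarrow> (\<forall>n\<ge>1. continuous_on X (f n) \<and> f n \<in> X \<rightarrow> X)"

text \<open>
  \<^term>\<open>nds_iter f i n\<close> is the composition of the \<^term>\<open>n\<close> maps with indices
  \<^term>\<open>i\<close> up to \<^term>\<open>i + n - 1\<close>, the map with index \<^term>\<open>i\<close> being applied first.
\<close>

primrec nds_iter :: "(nat \<Rightarrow> 'a \<Rightarrow> 'a) \<Rightarrow> nat \<Rightarrow> nat \<Rightarrow> 'a \<Rightarrow> 'a" where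
  "nds_iter f i 0 = id"
| "nds_iter f i (Suc n) = f (i + n) \<circ> nds_iter f i n"

definition nds_commutative :: "'a set \<Rightarrow> (nat \<Rightarrow> 'a \<Rightarrow> 'a) \<Rightarrow> bool" where
  "nds_commutative X f \<longleftrightarrow> (\<forall>i\<ge>1. \<forall>j\<ge>1. \<forall>x\<in>X. (f i \<circ> f j) x = (f j \<circ> f i) x)"

definition nds_transitive :: "'a::metric_space set \<Rightarrow> (nat \<Rightarrow> 'a \<Rightarrow> 'a) \<Rightarrow> bool" where
  "nds_transitive X f \<longleftrightarrow>
     (\<forall>U V. openin (top_of_set X) U \<and> U \<noteq> {} \<and> openin (top_of_set X) V \<and> V \<noteq> {} \<longrightarrow>
        (\<exists>n\<ge>1. nds_iter f 1 n ` U \<inter> V \<noteq> {}))"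

definition nds_fixed_point :: "'a set \<Rightarrow> (nat \<Rightarrow> 'a \<Rightarrow> 'a) \<Rightarrow> 'a \<Rightarrow> bool" where
  "nds_fixed_point X f x \<longleftrightarrow> x \<in> X \<and> (\<forall>n\<ge>1. nds_iter f 1 n x = x)"

text \<open>The limits inferior and superior are taken in the extended reals.\<close>

definition nds_li_yorke_chaotic :: "'a::metric_space set \<Rightarrow> (nat \<Rightarrow> 'a \<Rightarrow> 'a) \<Rightarrow> bool" where
  "nds_li_yorke_chaotic X f \<longleftrightarrow>
     (\<exists>S\<subseteq>X. uncountable S \<and>
        (\<forall>x\<in>S. \<forall>y\<in>S. x \<noteq> y \<longrightarrow>
           liminf (\<lambda>n. ereal (dist (nds_iter f 1 n x) (nds_iter f 1 n y))) = 0 \<and>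
           limsup (\<lambda>n. ereal (dist (nds_iter f 1 n x) (nds_iter f 1 n y))) > 0))"

end

theory Submission
  imports Defs
begin

text \<open>
  Let \<open>x\<close> be a point with dense orbit; such points form a comeager set. Since \<open>X\<close> is perfect, the
  orbit of \<open>x\<close> returns infinitely often to every neighbourhood of \<open>x\<close> and of the fixed point \<open>p\<close>.
  The iterates commute, so along times \<open>n\<close> at which the orbit of \<open>x\<close> is close to \<open>p\<close>, so is the
  orbit of \<open>f\<^sub>1\<^sup>m x\<close>, and along times at which \<open>x\<close> returns to itself, \<open>f\<^sub>1\<^sup>m x\<close> does so as well. Hence
  every \<open>y = f\<^sub>1\<^sup>m x\<close> satisfies
  \<open>liminf d(f\<^sub>1\<^sup>n x, f\<^sub>1\<^sup>n y) = 0\<close> and \<open>limsup d(f\<^sub>1\<^sup>n x, f\<^sub>1\<^sup>n y) \<ge> d(x, y)\<close>.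
  For fixed \<open>x\<close> these two conditions define a \<open>G\<^sub>\<delta>\<close> set of \<open>y\<close>, which is dense because it contains
  the orbit of \<open>x\<close>. By Baire, a maximal set of points with dense orbits that satisfy the conditions
  pairwise cannot be countable.
\<close>

section \<open>Comeager sets\<close>

text \<open>Only the trace of \<open>A\<close> on the space matters, so sets of points of the whole
  type can be used directly; intersecting with \<open>topspace Z\<close> also gives the empty family
  its intended meaning.\<close>

definition comeager_in :: "'a topology \<Rightarrow> 'a set \<Rightarrow> bool" where
  "comeager_in Z A \<longleftrightarrow>
     (\<exists>\<U>. countable \<U> \<and> (\<forall>U\<in>\<U>. openin Z U \<and> Z closure_of U = topspace Z) \<and>
          topspace Z \<inter> \<Inter>\<U> \<subseteq> A)"

lemma comeager_in_dense_open:
  assumes "openin Z U" and "\<And>V. openin Z V \<Longrightarrow> V \<noteq> {} \<Longrightarrow> U \<inter> V \<noteq> {}"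
  shows "comeager_in Z U"
proof -
  have "Z closure_of U = topspace Z"
    using assms(2) by (auto simp: dense_intersects_open)
  then show ?thesis
    unfolding comeager_in_def using assms(1) by (intro exI[of _ "{U}"]) auto
qed

lemma comeager_in_mono:
  "comeager_in Z A \<Longrightarrow> topspace Z \<inter> A \<subseteq> B \<Longrightarrow> comeager_in Z B"
  unfolding comeager_in_def by (meson Int_lower1 Int_subset_iff order_trans)

lemma comeager_in_INT:
  assumes "countable I" and "\<And>i. i \<in> I \<Longrightarrow> comeager_in Z (A i)"
  shows "comeager_in Z (\<Inter>i\<in>I. A i)"
proof -
  obtain \<U> where \<U>: "\<And>i. i \<in> I \<Longrightarrow> countable (\<U> i) \<and>
      (\<forall>U\<in>\<U> i. openin Z U \<and> Z closure_of U = topspace Z) \<and> topspace Z \<inter> \<Inter>(\<U> i) \<subseteq> A i"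
    using assms(2) unfolding comeager_in_def by metis
  have "topspace Z \<inter> \<Inter>(\<Union>i\<in>I. \<U> i) \<subseteq> A i" if "i \<in> I" for i
    using \<U>[OF that] that by blast
  then show ?thesis
    unfolding comeager_in_def using \<U> assms(1)
    by (intro exI[of _ "\<Union>i\<in>I. \<U> i"]) auto
qed

lemma comeager_in_Int:
  assumes "comeager_in Z A" and "comeager_in Z B"
  shows "comeager_in Z (A \<inter> B)"
  using comeager_in_INT[of "{A, B}" Z "\<lambda>C. C"] assms by auto

text \<open>This is where Baire's theorem enters.\<close>

lemma comeager_in_nonempty:
  assumes "completely_metrizable_space Z" and "topspace Z \<noteq> {}" and "comeager_in Z A"
  shows "topspace Z \<inter> A \<noteq> {}"
proof -
  obtain \<U> where \<U>: "countable \<U>" "\<And>U. U \<in> \<U> \<Longrightarrow> openin Z U \<and> Z closure_of U = topspace Z"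
      "topspace Z \<inter> \<Inter>\<U> \<subseteq> A"
    using assms(3) unfolding comeager_in_def by metis
  have "Z closure_of \<Inter>\<U> = topspace Z"
    by (rule Baire_category) (use assms(1) \<U> in auto)
  then have "topspace Z \<inter> \<Inter>\<U> \<noteq> {}"
    using assms(2) by (metis closure_of_empty closure_of_restrict)
  then show ?thesis
    using \<U>(3) by blast
qed

text \<open>Zorn's lemma yields a maximal pairwise related subset of \<open>T\<close>. Were it
  countable, countably many comeager conditions would leave a point with which to enlarge it; the
  clause \<open>y \<noteq> x\<close> makes that point new.\<close>

lemma uncountable_pairwise:
  assumes Z: "completely_metrizable_space Z" "topspace Z \<noteq> {}"
    and sym: "\<And>x y. R x y \<Longrightarrow> R y x"
    and T: "comeager_in Z T"
    and R: "\<And>x. x \<in> topspace Z \<inter> T \<Longrightarrow> comeager_in Z {y. y \<noteq> x \<and> R x y}"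
  shows "\<exists>S \<subseteq> topspace Z. uncountable S \<and> pairwise R S"
proof -
  define \<A> where "\<A> = {S. S \<subseteq> topspace Z \<inter> T \<and> pairwise R S}"
  have "\<exists>M\<in>\<A>. \<forall>S\<in>\<A>. M \<subseteq> S \<longrightarrow> S = M"
  proof (rule subset_Zorn')
    fix \<C> assume \<C>: "subset.chain \<A> \<C>"
    then have "\<C> \<subseteq> \<A>" and *: "\<And>S S'. S \<in> \<C> \<Longrightarrow> S' \<in> \<C> \<Longrightarrow> S \<subseteq> S' \<or> S' \<subseteq> S"
      by (auto simp: subset_chain_def)
    have "pairwise R (\<Union>\<C>)"
      unfolding pairwise_def
    proof (intro ballI impI)
      fix x y assume xy: "x \<in> \<Union>\<C>" "y \<in> \<Union>\<C>" "x \<noteq> y"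
      then obtain S where "S \<in> \<C>" "x \<in> S" "y \<in> S"
        using * by (meson UnionE subsetD)
      then show "R x y"
        using xy(3) \<open>\<C> \<subseteq> \<A>\<close> by (auto simp: \<A>_def pairwise_def)
    qed
    then show "\<Union>\<C> \<in> \<A>"
      using \<open>\<C> \<subseteq> \<A>\<close> by (auto simp: \<A>_def)
  qed
  then obtain M where M: "M \<in> \<A>" and max: "\<And>S. S \<in> \<A> \<Longrightarrow> M \<subseteq> S \<Longrightarrow> S = M"
    by blast
  have "uncountable M"
  proof
    assume "countable M"
    then have "comeager_in Z (T \<inter> (\<Inter>x\<in>M. {y. y \<noteq> x \<and> R x y}))"
      using M T R by (intro comeager_in_Int comeager_in_INT) (auto simp: \<A>_def)
    then obtain y where y: "y \<in> topspace Z" "y \<in> T" "\<And>x. x \<in> M \<Longrightarrow> y \<noteq> x \<and> R x y"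
      using comeager_in_nonempty[OF Z] by blast
    then have "insert y M \<in> \<A>"
      using M sym by (auto simp: \<A>_def pairwise_insert)
    then show False
      using max y(3) by blast
  qed
  then show ?thesis
    using M by (auto simp: \<A>_def)
qed

lemma completely_metrizable_compact:
  fixes X :: "'a::metric_space set"
  assumes "compact X"
  shows "completely_metrizable_space (top_of_set X)"
proof -
  have "compact_space (top_of_set X)"
    using assms by (simp add: compact_space_subtopology)
  moreover have "metrizable_space (top_of_set X)"
    using Met_TC.metrizable_space_mtopology metrizable_space_subtopology by fastforce
  ultimately show ?thesis
    by (metis Metric_space.compact_space_imp_mcomplete completely_metrizable_space_def
        metrizable_space_def)
qed

section \<open>Transitive commutative systems with a fixed point\<close>

locale transitive_commutative_nds =
  fixes X :: "'a::metric_space set" and f :: "nat \<Rightarrow> 'a \<Rightarrow> 'a" and p :: 'a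
  assumes nds: "nds X f"
    and compact: "compact X"
    and islimpt: "x \<in> X \<Longrightarrow> x islimpt X"
    and commutative: "nds_commutative X f"
    and transitive: "nds_transitive X f"
    and fixed: "nds_fixed_point X f p"
begin

section \<open>Iterates and their commutation\<close>

abbreviation g :: "nat \<Rightarrow> 'a \<Rightarrow> 'a" where
  "g \<equiv> nds_iter f 1"

lemma infinite_open:
  assumes "openin (top_of_set X) V" and "V \<noteq> {}"
  shows "infinite V"
proof -
  obtain U v where U: "open U" "V = X \<inter> U" "v \<in> X" "v \<in> U"
    using assms by (auto simp: openin_open)
  then show ?thesis
    using islimpt[of v] by (auto simp: islimpt_eq_acc_point Int_commute)
qed

lemma p_in: "p \<in> X"
  using fixed by (simp add: nds_fixed_point_def)

lemma iterate_fixed: "g n p = p"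
  using fixed by (cases "n = 0") (auto simp: nds_fixed_point_def)

lemma iterate_in: "x \<in> X \<Longrightarrow> g n x \<in> X"
  using nds by (induction n) (auto simp: nds_def)

lemma continuous_on_iterate: "continuous_on X (g n)"
proof (induction n)
  case (Suc n)
  have "continuous_on (g n ` X) (f (1 + n))"
    using nds iterate_in by (auto simp: nds_def intro: continuous_on_subset[of X "f (Suc n)"])
  with Suc show ?case
    using continuous_on_compose[of X "g n" "f (1 + n)"] by simp
qed (auto simp: id_def)

text \<open>A single map is first moved past an iterate, then a second induction moves all of
  \<open>g m\<close>. Commutativity is known on \<open>X\<close> only, so each step needs the
  iterates to stay in \<open>X\<close>.\<close>

lemma iterate_commute:
  assumes "x \<in> X"
  shows "g m (g n x) = g n (g m x)"
proof -
  have 1: "f (Suc i) (g n x) = g n (f (Suc i) x)" if "x \<in> X" for i n x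
  proof (induction n)
    case (Suc n)
    have "f (Suc i) (f (Suc n) (g n x)) = f (Suc n) (f (Suc i) (g n x))"
      using commutative iterate_in[OF that, of n] by (simp add: nds_commutative_def)
    with Suc show ?case
      by simp
  qed auto
  show ?thesis
    by (induction m) (use 1 iterate_in[OF assms] in auto)
qed

section \<open>Points with dense orbit\<close>

definition dense_orbit :: "'a \<Rightarrow> bool" where
  "dense_orbit x \<longleftrightarrow> (\<forall>V. openin (top_of_set X) V \<and> V \<noteq> {} \<longrightarrow> (\<exists>n. g n x \<in> V))"

text \<open>The factor \<open>c\<close> lets one statement serve both halves of
  \<open>scrambled\<close>: 0 for proximality, 1 for the lower bound by the initial
  distance.\<close>

lemma openin_iterate_dist:
  assumes "y \<in> X" and "open A"
  shows "openin (top_of_set X) {x \<in> X. dist (g n y) (g n x) - c * dist y x \<in> A}"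
proof -
  have "continuous_on X (\<lambda>x. dist (g n y) (g n x) - c * dist y x)"
    by (intro continuous_intros continuous_on_iterate)
  from continuous_openin_preimage_gen[OF this assms(2)] show ?thesis
    by (simp add: vimage_def Int_def)
qed

text \<open>Total boundedness supplies finite nets of radius \<open>1/(k+1)\<close>, whose balls act
  as a countable base. The points whose orbit enters a given ball form an open set by continuity and
  a dense one by transitivity.\<close>

lemma comeager_dense_orbit: "comeager_in (top_of_set X) {x. dense_orbit x}"
proof -
  have "\<exists>D. finite D \<and> D \<subseteq> X \<and> X \<subseteq> (\<Union>c\<in>D. ball c (inverse (Suc k)))" for k
    using seq_compact_imp_totally_bounded[OF compact_imp_seq_compact[OF compact]] by simp
  then obtain D where D: "\<And>k. finite (D k)" "\<And>k. D k \<subseteq> X"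
      "\<And>k. X \<subseteq> (\<Union>c\<in>D k. ball c (inverse (Suc k)))"
    by metis
  define W where "W = (\<lambda>(k, c). \<Union>n. {x \<in> X. g n x \<in> ball c (inverse (Suc k))})"
  define I where "I = (SIGMA k:UNIV. D k)"
  have "comeager_in (top_of_set X) (W (k, c))" if c: "c \<in> D k" for k c
  proof (rule comeager_in_dense_open)
    have "openin (top_of_set X) {x \<in> X. g n x \<in> ball c (inverse (Suc k))}" for n
      using continuous_openin_preimage_gen[OF continuous_on_iterate[of n] open_ball]
      by (simp add: vimage_def Int_def)
    then show "openin (top_of_set X) (W (k, c))"
      by (auto simp: W_def)
    fix V assume V: "openin (top_of_set X) V" "V \<noteq> {}"
    have "openin (top_of_set X) (X \<inter> ball c (inverse (Suc k)))"
      by (simp add: openin_open_Int)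
    moreover have "c \<in> X \<inter> ball c (inverse (Suc k))"
      using c D(2) by auto
    ultimately obtain n where "g n ` V \<inter> (X \<inter> ball c (inverse (Suc k))) \<noteq> {}"
      using transitive V unfolding nds_transitive_def by (metis empty_iff)
    then obtain v where "v \<in> V" "g n v \<in> ball c (inverse (Suc k))"
      by blast
    then have "v \<in> W (k, c) \<inter> V"
      using openin_imp_subset[OF V(1)] unfolding W_def by blast
    then show "W (k, c) \<inter> V \<noteq> {}"
      by blast
  qed
  moreover have "countable I"
    using D(1) by (auto simp: I_def intro: countable_finite)
  ultimately have "comeager_in (top_of_set X) (\<Inter>i\<in>I. W i)"
    by (intro comeager_in_INT) (auto simp: I_def)
  then show ?thesis
  proof (rule comeager_in_mono, safe)
    fix x assume x: "x \<in> topspace (top_of_set X)" "x \<in> (\<Inter>i\<in>I. W i)"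
    show "dense_orbit x"
      unfolding dense_orbit_def
    proof (intro allI impI, elim conjE)
      fix V assume V: "openin (top_of_set X) V" "V \<noteq> {}"
      then obtain v where v: "v \<in> V" "v \<in> X"
        using openin_imp_subset by blast
      obtain e where e: "e > 0" "\<And>y. y \<in> X \<Longrightarrow> dist y v < e \<Longrightarrow> y \<in> V"
        using V(1) v(1) unfolding openin_euclidean_subtopology_iff by metis
      \<comment> \<open>Half of \<open>e\<close>, since both \<open>v\<close> and the orbit point
        will lie within this radius of the net point \<open>c\<close>.\<close>
      obtain k where k: "inverse (Suc k) < e / 2"
        using reals_Archimedean[of "e / 2"] e(1) by auto
      obtain c where c: "c \<in> D k" "dist c v < inverse (Suc k)"
        using D(3)[of k] v(2) by auto
      have "x \<in> W (k, c)"
        using x(2) c(1) by (auto simp: I_def)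
      then obtain n where "dist c (g n x) < inverse (Suc k)"
        by (auto simp: W_def)
      then have "dist (g n x) v < e"
        using c(2) k dist_triangle3[of "g n x" v c] by linarith
      then show "\<exists>n. g n x \<in> V"
        using e(2) iterate_in x(1) by auto
    qed
  qed
qed

text \<open>Deleting the first \<open>N\<close> orbit points from \<open>U\<close> leaves a nonempty
  open subset of \<open>X\<close>, as \<open>X\<close> is perfect; the orbit can visit it only at a
  time \<open>n \<ge> N\<close>.\<close>

lemma dense_orbit_frequently:
  assumes x: "dense_orbit x" and U: "open U" "y \<in> U" "y \<in> X"
  shows "\<exists>\<^sub>F n in sequentially. g n x \<in> U"
  unfolding frequently_sequentially
proof
  fix N
  let ?F = "(\<lambda>n. g n x) ` {..<N}"
  have "infinite (X \<inter> U)"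
    using U by (intro infinite_open) (auto simp: openin_open_Int)
  then have "X \<inter> (U - ?F) \<noteq> {}"
    by (metis Diff_eq_empty_iff Int_Diff finite_imageI finite_lessThan finite_subset)
  moreover have "openin (top_of_set X) (X \<inter> (U - ?F))"
    using U(1) by (intro openin_open_Int open_Diff finite_imp_closed) auto
  ultimately obtain n where "g n x \<in> X \<inter> (U - ?F)"
    using x unfolding dense_orbit_def by blast
  then show "\<exists>n\<ge>N. g n x \<in> U"
    by (intro exI[of _ n]) (auto simp: not_less[symmetric])
qed

section \<open>Scrambled pairs\<close>

text \<open>
  The bound \<open>dist x y\<close>, rather than a constant, keeps the relation a dense \<open>G\<^sub>\<delta>\<close> even when
  the system is not sensitive to initial conditions.
\<close>

definition scrambled :: "'a \<Rightarrow> 'a \<Rightarrow> bool" where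
  "scrambled x y \<longleftrightarrow>
     (\<forall>e>0. \<exists>\<^sub>F n in sequentially. dist (g n x) (g n y) < e) \<and>
     (\<forall>e>0. \<exists>\<^sub>F n in sequentially. dist x y - e < dist (g n x) (g n y))"

lemma scrambled_commute: "scrambled x y \<Longrightarrow> scrambled y x"
  by (simp add: scrambled_def dist_commute)

lemma scrambled_orbit:
  assumes x: "dense_orbit x" "x \<in> X"
  shows "scrambled x (g m x)"
proof -
  have *: "\<exists>\<^sub>F n in sequentially. \<bar>dist (g n x) (g n (g m x)) - dist y (g m y)\<bar> < e"
    if "e > 0" "y \<in> X" for e y
  proof -
    \<comment> \<open>By commutation, the distance at time \<open>n\<close> is this function
      evaluated at \<open>g n x\<close>, so it is close to its value at \<open>y\<close> whenever
      \<open>g n x\<close> is close to \<open>y\<close>.\<close>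
    have "continuous_on X (\<lambda>z. dist z (g m z))"
      by (intro continuous_intros continuous_on_iterate)
    then obtain d where d: "d > 0"
        "\<And>z. z \<in> X \<Longrightarrow> dist z y < d \<Longrightarrow> dist (dist z (g m z)) (dist y (g m y)) < e"
      using \<open>e > 0\<close> \<open>y \<in> X\<close> unfolding continuous_on_iff by metis
    have "\<exists>\<^sub>F n in sequentially. g n x \<in> ball y d"
      using dense_orbit_frequently[OF x(1) open_ball _ \<open>y \<in> X\<close>] d(1) by auto
    then show ?thesis
    proof (rule frequently_elim1)
      fix n assume "g n x \<in> ball y d"
      then show "\<bar>dist (g n x) (g n (g m x)) - dist y (g m y)\<bar> < e"
        using d(2)[OF iterate_in[OF x(2)], of n] iterate_commute[OF x(2), of n m]
        by (simp add: dist_commute dist_real_def)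
    qed
  qed
  show ?thesis
    unfolding scrambled_def
  proof (intro conjI allI impI)
    fix e :: real assume e: "e > 0"
    \<comment> \<open>The choice \<open>y = p\<close> gives limit value 0; below,
      \<open>y = x\<close> gives \<open>dist x (g m x)\<close>.\<close>
    show "\<exists>\<^sub>F n in sequentially. dist (g n x) (g n (g m x)) < e"
      using *[OF e p_in, unfolded iterate_fixed] by simp
    show "\<exists>\<^sub>F n in sequentially. dist x (g m x) - e < dist (g n x) (g n (g m x))"
      using *[OF e x(2)] by (rule frequently_elim1) linarith
  qed
qed

text \<open>The set is the intersection over \<open>k\<close> and \<open>N\<close> of open sets,
  each dense because it contains the whole orbit of \<open>x\<close>.\<close>

lemma comeager_frequently_dist:
  assumes x: "dense_orbit x" "x \<in> X" and A: "\<And>k. open (A k)"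
    and orbit: "\<And>k m. \<exists>\<^sub>F n in sequentially.
      dist (g n x) (g n (g m x)) - c * dist x (g m x) \<in> A k"
  shows "comeager_in (top_of_set X)
    {y. \<forall>k::nat. \<exists>\<^sub>F n in sequentially. dist (g n x) (g n y) - c * dist x y \<in> A k}"
proof -
  define W where
    "W = (\<lambda>(k, N). \<Union>n\<in>{N..}. {y \<in> X. dist (g n x) (g n y) - c * dist x y \<in> A k})"
  have "comeager_in (top_of_set X) (W (k, N))" for k N
  proof (rule comeager_in_dense_open)
    show "openin (top_of_set X) (W (k, N))"
      using openin_iterate_dist[OF x(2) A] by (auto simp: W_def)
    fix V assume V: "openin (top_of_set X) V" "V \<noteq> {}"
    then obtain m where "g m x \<in> V"
      using x(1) by (auto simp: dense_orbit_def)
    moreover have "g m x \<in> W (k, N)"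
      using orbit[of m k] iterate_in[OF x(2)]
      by (auto simp: W_def frequently_sequentially)
    ultimately show "W (k, N) \<inter> V \<noteq> {}"
      by blast
  qed
  then have "comeager_in (top_of_set X) (\<Inter>i. W i)"
    by (intro comeager_in_INT) auto
  then show ?thesis
    by (rule comeager_in_mono) (fastforce simp: W_def frequently_sequentially)
qed

lemma comeager_scrambled:
  assumes x: "dense_orbit x" "x \<in> X"
  shows "comeager_in (top_of_set X) {y. y \<noteq> x \<and> scrambled x y}"
proof -
  \<comment> \<open>Countably many tolerances replace the quantification over all positive
    reals.\<close>
  let ?e = "\<lambda>k. inverse (real (Suc k))"
  \<comment> \<open>Nonempty open sets are infinite, so deleting one point keeps density.\<close>
  have "comeager_in (top_of_set X) (X - {x})"
  proof (rule comeager_in_dense_open)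
    show "openin (top_of_set X) (X - {x})"
      by (simp add: openin_delete)
    fix V assume V: "openin (top_of_set X) V" "V \<noteq> {}"
    then have "V - {x} \<noteq> {}"
      using infinite_open by (metis finite.simps Diff_eq_empty_iff finite_subset)
    then show "(X - {x}) \<inter> V \<noteq> {}"
      using openin_imp_subset[OF V(1)] by blast
  qed
  moreover have "comeager_in (top_of_set X)
      {y. \<forall>k. \<exists>\<^sub>F n in sequentially. dist (g n x) (g n y) - 0 * dist x y \<in> {..<?e k}}"
    using scrambled_orbit[OF x] 
    by (intro comeager_frequently_dist x open_lessThan) (simp add: scrambled_def)
  moreover have "comeager_in (top_of_set X)
      {y. \<forall>k. \<exists>\<^sub>F n in sequentially. dist (g n x) (g n y) - 1 * dist x y \<in> {- ?e k<..}}"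
  proof (intro comeager_frequently_dist x open_greaterThan)
    fix k m
    have "\<exists>\<^sub>F n in sequentially. dist x (g m x) - ?e k < dist (g n x) (g n (g m x))"
      using scrambled_orbit[OF x, of m] by (simp add: scrambled_def)
    then show "\<exists>\<^sub>F n in sequentially.
        dist (g n x) (g n (g m x)) - 1 * dist x (g m x) \<in> {- ?e k<..}"
      by (rule frequently_elim1) auto
  qed
  ultimately have "comeager_in (top_of_set X) ((X - {x}) \<inter>
      ({y. \<forall>k. \<exists>\<^sub>F n in sequentially. dist (g n x) (g n y) - 0 * dist x y \<in> {..<?e k}} \<inter>
       {y. \<forall>k. \<exists>\<^sub>F n in sequentially. dist (g n x) (g n y) - 1 * dist x y \<in> {- ?e k<..}}))"
    by (intro comeager_in_Int)
  then show ?thesis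
  proof (rule comeager_in_mono, intro subsetI CollectI conjI, goal_cases)
    case (2 y)
    show ?case
      unfolding scrambled_def
    proof (intro conjI allI impI)
      fix e :: real assume "e > 0"
      then obtain k where k: "?e k < e"
        using reals_Archimedean by blast
      have "\<exists>\<^sub>F n in sequentially. dist (g n x) (g n y) < ?e k"
        using 2 by simp
      then show "\<exists>\<^sub>F n in sequentially. dist (g n x) (g n y) < e"
        by (rule frequently_elim1) (use k in linarith)
      have "\<exists>\<^sub>F n in sequentially. - ?e k < dist (g n x) (g n y) - dist x y"
        using 2 by simp
      then show "\<exists>\<^sub>F n in sequentially. dist x y - e < dist (g n x) (g n y)"
        by (rule frequently_elim1) (use k in linarith)
    qed
  qed auto
qed

lemma scrambled_liminf_limsup:
  assumes "scrambled x y" and "x \<noteq> y"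
  shows "liminf (\<lambda>n. ereal (dist (g n x) (g n y))) = 0"
    and "limsup (\<lambda>n. ereal (dist (g n x) (g n y))) > 0"
proof -
  let ?d = "\<lambda>n. ereal (dist (g n x) (g n y))"
  show "liminf ?d = 0"
  proof (rule antisym)
    show "liminf ?d \<le> 0"
    proof (rule ccontr)
      assume "\<not> liminf ?d \<le> 0"
      then obtain e where e: "0 < ereal e" "ereal e < liminf ?d"
        using ereal_dense2[of 0 "liminf ?d"] by (auto simp: not_le)
      from less_LiminfD[OF e(2)] have "\<forall>\<^sub>F n in sequentially. \<not> dist (g n x) (g n y) < e"
        by eventually_elim auto
      then show False
        using assms(1) e(1) by (auto simp: scrambled_def frequently_def)
    qed
  qed (auto intro: Liminf_bounded)
  show "limsup ?d > 0"
  proof (rule ccontr)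
    assume "\<not> limsup ?d > 0"
    \<comment> \<open>Half the initial distance is positive as \<open>x \<noteq> y\<close>, hence
      exceeds the limsup; the same half is the tolerance at which \<open>scrambled\<close> is
      contradicted.\<close>
    then have "limsup ?d < ereal (dist x y / 2)"
      using assms(2) by (auto simp: not_less intro: le_less_trans)
    from Limsup_lessD[OF this]
    have "\<forall>\<^sub>F n in sequentially. \<not> dist x y - dist x y / 2 < dist (g n x) (g n y)"
      by eventually_elim auto
    then show False
      using assms by (auto simp: scrambled_def frequently_def dest!: spec[of _ "dist x y / 2"])
  qed
qed

lemma li_yorke_chaotic: "nds_li_yorke_chaotic X f"
proof -
  \<comment> \<open>The fixed point shows that the space is nonempty, as the Baire argument
    requires.\<close>
  have "\<exists>S \<subseteq> topspace (top_of_set X). uncountable S \<and> pairwise scrambled S"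
    using p_in compact comeager_dense_orbit comeager_scrambled scrambled_commute
    by (intro uncountable_pairwise[where T = "{x. dense_orbit x}"] completely_metrizable_compact)
       auto
  then obtain S where S: "S \<subseteq> X" "uncountable S" "pairwise scrambled S"
    by auto
  show ?thesis
    unfolding nds_li_yorke_chaotic_def
    using S(1,2) scrambled_liminf_limsup pairwiseD[OF S(3)]
    by (intro exI[of _ S] conjI ballI impI) auto
qed

end

theorem theorem1:
  fixes X :: "'a::metric_space set" and f :: "nat \<Rightarrow> 'a \<Rightarrow> 'a"
  assumes "nds X f"
    and "compact X"
    and "\<not> (\<exists>x. x isolated_in X)"
    and "nds_commutative X f"
    and "nds_transitive X f"
    and "\<exists>x. nds_fixed_point X f x"
  shows "nds_li_yorke_chaotic X f"
proof -
  obtain p where "nds_fixed_point X f p"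
    using assms(6) by blast
  then interpret transitive_commutative_nds X f p
    using assms by unfold_locales (auto simp: isolated_in_islimpt_iff)
  show ?thesis
    by (rule li_yorke_chaotic)
qed

end
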